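(* The set $\mathcal{P}$ of Gaussian primes is dense in $(\mathbb{Z}[i]\setminus\{0\},\mathcal{T})$, where $\mathcal{T}$ is the coprimality topology. Equivalently, for every $\alpha\in\mathbb{Z}[i]\setminus\{0\}$, the basic open set $\sigma_\alpha$ contains a Gaussian prime.
   Context: $\mathbb{Z}[i]$ is the ring of Gaussian integers; a Gaussian prime is a prime element of $\mathbb{Z}[i]$. $\gcd(\alpha,\beta)\sim 1$ means that $\alpha$ and $\beta$ are coprime, i.e. their greatest common divisor is a unit. For $\alpha\in\mathbb{Z}[i]\setminus\{0\}$ put $\sigma_\alpha=\{\beta\in\mathbb{Z}[i]\setminus\{0\}:\gcd(\alpha,\beta)\sim 1\}$. The coprimality topology $\mathcal{T}$ on $\mathbb{Z}[i]\setminus\{0\}$ is the topology generated by the collection $\{\sigma_\alpha:\alpha\in\mathbb{Z}[i]\setminus\{0\}\}$, whose members are called basic open sets. *)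

theory Defs
  imports
    "HOL-Analysis.Abstract_Topology"
    "HOL-Computational_Algebra.Factorial_Ring"
begin

typedef gauss_int = "{z :: complex. Re z \<in> \<int> \<and> Im z \<in> \<int>}"
  morphisms complex_of_gauss Abs_gauss_int
  by (rule exI[of _ 0]) simp

setup_lifting type_definition_gauss_int

text \<open>
  Division rounds the complex quotient to a nearest Gaussian integer, as for the Euclidean
  algorithm; it agrees with exact division whenever the latter is possible. It is needed only
  because the library notion \<^const>\<open>coprime\<close> lives in a class that provides a division;
  the notion itself refers only to divisibility.
\<close>

instantiation gauss_int :: idom_divide
begin

lift_definition zero_gauss_int :: gauss_int is 0 by simp
lift_definition one_gauss_int :: gauss_int is 1 by simp
lift_definition plus_gauss_int :: "gauss_int \<Rightarrow> gauss_int \<Rightarrow> gauss_int" is "(+)" by simp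
lift_definition minus_gauss_int :: "gauss_int \<Rightarrow> gauss_int \<Rightarrow> gauss_int" is "(-)" by simp
lift_definition uminus_gauss_int :: "gauss_int \<Rightarrow> gauss_int" is "uminus" by simp
lift_definition times_gauss_int :: "gauss_int \<Rightarrow> gauss_int \<Rightarrow> gauss_int" is "(*)" by simp
lift_definition divide_gauss_int :: "gauss_int \<Rightarrow> gauss_int \<Rightarrow> gauss_int"
  is "\<lambda>z w. Complex (of_int (round (Re (z / w)))) (of_int (round (Im (z / w))))" by simp

instance
proof
  fix a b :: gauss_int
  show "a * b div b = a" if "b \<noteq> 0"
    using that by transfer (auto simp: complex_eq_iff elim!: Ints_cases)
  show "a div 0 = 0"
    by transfer (simp add: complex_eq_iff)
qed (transfer; simp add: algebra_simps)+

end

instance gauss_int :: algebraic_semidom ..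

definition coprime_set :: "gauss_int \<Rightarrow> gauss_int set"
  where "coprime_set \<alpha> = {\<beta>. \<beta> \<noteq> 0 \<and> coprime \<alpha> \<beta>}"

definition coprimality_topology :: "gauss_int topology"
  where "coprimality_topology = topology_generated_by (coprime_set ` (UNIV - {0}))"

lemma topspace_coprimality_topology: "topspace coprimality_topology = UNIV - {0}"
proof -
  have "coprime_set 1 = UNIV - {0}"
    by (auto simp: coprime_set_def)
  moreover have "(1 :: gauss_int) \<in> UNIV - {0}"
    by simp
  moreover have "coprime_set \<alpha> \<subseteq> UNIV - {0}" for \<alpha>
    by (auto simp: coprime_set_def)
  ultimately show ?thesis
    unfolding coprimality_topology_def topology_generated_by_topspace by blast
qed

end

theory Submission
  imports Defs
begin

text \<open>
  A Gaussian prime avoiding \<open>\<alpha>\<close> is found as in Euclid's proof that there are infinitely many primes.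
  The number \<open>1 + 3 * \<alpha>\<close> is coprime to \<open>\<alpha>\<close> and too large to be a unit, so it has an irreducible
  divisor \<open>p\<close> (\<open>irreducible_divisor_exists\<close>), and \<open>p\<close> inherits the coprimality to \<open>\<alpha>\<close>. Irreducible
  elements are prime because of division with remainder (\<open>irreducible_imp_prime_elem_gauss\<close>);
  this is shown by a direct descent on the norm, which avoids setting up greatest common divisors.

  Density reduces to this existence statement. A multiple of \<open>\<alpha>\<close> and \<open>\<beta>\<close> is coprime to fewer
  elements, so \<open>\<sigma>\<^bsub>\<alpha>\<beta>\<^esub>\<close> lies inside \<open>\<sigma>\<^bsub>\<alpha>\<^esub> \<inter> \<sigma>\<^bsub>\<beta>\<^esub>\<close>, and therefore every nonempty open set
  contains some \<open>\<sigma>\<^bsub>\<alpha>\<^esub>\<close> (\<open>nonempty_openin_contains_coprime_set\<close>).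
\<close>

section \<open>Norm and division with remainder\<close>

text \<open>
  The norm is natural-valued, so that it can serve as a measure for descent; rounding down
  loses nothing, since \<open>Re\<close> and \<open>Im\<close> are integers.
\<close>

definition gauss_norm :: "gauss_int \<Rightarrow> nat"
  where "gauss_norm z = nat \<lfloor>(cmod (complex_of_gauss z))\<^sup>2\<rfloor>"

lemma real_gauss_norm: "real (gauss_norm z) = (cmod (complex_of_gauss z))\<^sup>2"
proof -
  have "Re (complex_of_gauss z) \<in> \<int>" "Im (complex_of_gauss z) \<in> \<int>"
    using complex_of_gauss[of z] by auto
  then have "(cmod (complex_of_gauss z))\<^sup>2 \<in> \<int>"
    unfolding cmod_power2 by (intro Ints_add Ints_power)
  then obtain k where "(cmod (complex_of_gauss z))\<^sup>2 = of_int k"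
    by (auto elim: Ints_cases)
  moreover from this have "k \<ge> 0"
    by (metis of_int_0_le_iff zero_le_power2)
  ultimately show ?thesis
    by (simp add: gauss_norm_def)
qed

lemma gauss_norm_mult: "gauss_norm (a * b) = gauss_norm a * gauss_norm b"
proof -
  have "real (gauss_norm (a * b)) = real (gauss_norm a * gauss_norm b)"
    by (simp add: real_gauss_norm times_gauss_int.rep_eq norm_mult power_mult_distrib)
  then show ?thesis
    by (simp only: of_nat_eq_iff)
qed

lemma gauss_norm_eq_0_iff: "gauss_norm z = 0 \<longleftrightarrow> z = 0"
proof -
  have "gauss_norm z = 0 \<longleftrightarrow> complex_of_gauss z = 0"
    using real_gauss_norm[of z] by auto
  then show ?thesis
    by (metis complex_of_gauss_inject zero_gauss_int.rep_eq)
qed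

lemma gauss_norm_le_of_dvd:
  assumes "a dvd b" "b \<noteq> 0"
  shows "gauss_norm a \<le> gauss_norm b"
proof -
  have "gauss_norm a dvd gauss_norm b"
    using assms(1) by (auto simp: gauss_norm_mult elim!: dvdE)
  then show ?thesis
    using assms(2) gauss_norm_eq_0_iff[of b] by (intro dvd_imp_le) auto
qed

text \<open>
  Rounding moves each coordinate of the exact quotient by at most \<open>1/2\<close>, so the quotient moves
  by at most \<open>sqrt (1/2) < 1\<close> in absolute value.
\<close>

lemma gauss_norm_remainder_less:
  assumes "b \<noteq> 0"
  shows "gauss_norm (a - a div b * b) < gauss_norm b"
proof -
  define z w where "z = complex_of_gauss a" and "w = complex_of_gauss b"
  define q where "q = Complex (of_int (round (Re (z / w)))) (of_int (round (Im (z / w))))"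
  have w: "w \<noteq> 0"
    using assms by (metis complex_of_gauss_inject w_def zero_gauss_int.rep_eq)
  have "\<bar>Re (z / w - q)\<bar> \<le> 1 / 2" "\<bar>Im (z / w - q)\<bar> \<le> 1 / 2"
    using of_int_round_abs_le[of "Re (z / w)"] of_int_round_abs_le[of "Im (z / w)"]
    by (simp_all add: q_def abs_minus_commute)
  then have "(Re (z / w - q))\<^sup>2 \<le> (1 / 2)\<^sup>2" "(Im (z / w - q))\<^sup>2 \<le> (1 / 2)\<^sup>2"
    using power_mono[of "\<bar>Re (z / w - q)\<bar>" "1 / 2" 2] power_mono[of "\<bar>Im (z / w - q)\<bar>" "1 / 2" 2]
    by simp_all
  then have q_close: "(cmod (z / w - q))\<^sup>2 < 1"
    unfolding cmod_power2 by (simp add: power2_eq_square)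
  have "complex_of_gauss (a - a div b * b) = (z / w - q) * w"
    using w by (simp add: minus_gauss_int.rep_eq times_gauss_int.rep_eq divide_gauss_int.rep_eq
        z_def w_def q_def left_diff_distrib)
  then have "real (gauss_norm (a - a div b * b)) = (cmod (z / w - q))\<^sup>2 * (cmod w)\<^sup>2"
    by (simp add: real_gauss_norm norm_mult power_mult_distrib)
  also have "\<dots> < 1 * (cmod w)\<^sup>2"
    using q_close w by (intro mult_strict_right_mono) auto
  also have "\<dots> = real (gauss_norm b)"
    by (simp add: real_gauss_norm w_def)
  finally show ?thesis
    by simp
qed

lemma is_unit_gauss_iff: "is_unit z \<longleftrightarrow> gauss_norm z = 1"
proof
  have norm_1: "gauss_norm 1 = 1"
    by (simp add: gauss_norm_def one_gauss_int.rep_eq)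
  show "gauss_norm z = 1" if "is_unit z"
    using that norm_1 by (metis dvdE gauss_norm_mult nat_mult_eq_1_iff)
  show "is_unit z" if "gauss_norm z = 1"
  proof -
    have "z \<noteq> 0"
      using that gauss_norm_eq_0_iff[of z] by auto
    \<comment> \<open>Dividing \<open>1\<close> by \<open>z\<close> leaves a remainder of norm less than \<open>1\<close>.\<close>
    then have "1 - 1 div z * z = 0"
      using gauss_norm_remainder_less[of z 1] that by (simp add: gauss_norm_eq_0_iff)
    then show ?thesis
      using dvd_triv_right[of z "1 div z"] by simp
  qed
qed

section \<open>Irreducible and prime elements\<close>

text \<open>A nonunit divisor of least norm cannot be split further.\<close>

lemma irreducible_divisor_exists:
  fixes z :: gauss_int
  assumes "z \<noteq> 0" "\<not> is_unit z"
  obtains p where "irreducible p" "p dvd z"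
proof -
  obtain p where p: "p dvd z" "\<not> is_unit p"
    and least: "\<And>d. d dvd z \<Longrightarrow> \<not> is_unit d \<Longrightarrow> gauss_norm p \<le> gauss_norm d"
    using ex_has_least_nat[of "\<lambda>d. d dvd z \<and> \<not> is_unit d" z gauss_norm] assms
    by auto
  have "p \<noteq> 0"
    using p assms by auto
  have "is_unit a \<or> is_unit b" if "p = a * b" for a b
  proof (rule ccontr)
    assume nonunits: "\<not> (is_unit a \<or> is_unit b)"
    have "a dvd z"
      using p that by (metis dvd_mult_left)
    then have "gauss_norm a * gauss_norm b \<le> gauss_norm a"
      using least nonunits that by (metis gauss_norm_mult)
    moreover have "a \<noteq> 0" "b \<noteq> 0"
      using \<open>p \<noteq> 0\<close> that by auto
    ultimately have "gauss_norm b = 1"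
      using gauss_norm_eq_0_iff[of a] gauss_norm_eq_0_iff[of b] by simp
    then show False
      using nonunits is_unit_gauss_iff by blast
  qed
  with p \<open>p \<noteq> 0\<close> have "irreducible p"
    by (intro irreducibleI) auto
  with p show thesis
    using that by blast
qed

text \<open>
  Suppose \<open>p\<close> divides \<open>a * b\<close> but neither factor. Keep \<open>b\<close> and replace \<open>a\<close> by an element \<open>c\<close> of least
  norm with \<open>p dvd c * b\<close> and not \<open>p dvd c\<close>. Subtracting multiples of \<open>p\<close> from \<open>c\<close>, or of \<open>c\<close> from \<open>p\<close>,
  keeps the product with \<open>b\<close> divisible by \<open>p\<close>, so minimality forces \<open>c\<close> to divide \<open>p\<close>. By
  irreducibility \<open>c\<close> is a unit or an associate of \<open>p\<close>, and both are absurd.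
\<close>

lemma irreducible_imp_prime_elem_gauss:
  fixes p :: gauss_int
  assumes "irreducible p"
  shows "prime_elem p"
proof (rule prime_elemI)
  show "p \<noteq> 0" "\<not> is_unit p"
    using assms by (auto simp: irreducible_def)
  fix a b
  assume "p dvd a * b"
  show "p dvd a \<or> p dvd b"
  proof (rule ccontr)
    assume not_dvd: "\<not> (p dvd a \<or> p dvd b)"
    obtain c where c: "p dvd c * b" "\<not> p dvd c"
      and least: "\<And>d. p dvd d * b \<Longrightarrow> \<not> p dvd d \<Longrightarrow> gauss_norm c \<le> gauss_norm d"
      using ex_has_least_nat[of "\<lambda>c. p dvd c * b \<and> \<not> p dvd c" a gauss_norm]
        \<open>p dvd a * b\<close> not_dvd by auto
    have smaller: "p dvd d" if "p dvd d * b" "gauss_norm d < gauss_norm c" for d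
      using least[of d] that by auto
    have "c \<noteq> 0"
      using c by auto
    define r where "r = p - p div c * c"
    have r_less: "gauss_norm r < gauss_norm c"
      unfolding r_def using \<open>c \<noteq> 0\<close> by (rule gauss_norm_remainder_less)
    have "r * b = p * b - p div c * (c * b)"
      by (simp add: r_def algebra_simps)
    then have "p dvd r * b"
      using c by (simp add: dvd_diff)
    then have "p dvd r"
      using smaller r_less by blast
    \<comment> \<open>A multiple \<open>r\<close> of \<open>p\<close> vanishes once its norm is below that of \<open>p\<close>; for this, \<open>c\<close> must be
      reduced modulo \<open>p\<close>, which its minimality guarantees.\<close>
    have "gauss_norm c < gauss_norm p"
    proof -
      define s where "s = c - c div p * p"
      have "gauss_norm s < gauss_norm p"
        unfolding s_def using \<open>p \<noteq> 0\<close> by (rule gauss_norm_remainder_less)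
      moreover have "s * b = c * b - p * (c div p * b)"
        by (simp add: s_def algebra_simps)
      then have "p dvd s * b"
        using c by (simp add: dvd_diff)
      moreover have "\<not> p dvd s"
      proof
        assume "p dvd s"
        then have "p dvd s + c div p * p"
          by (intro dvd_add) auto
        then show False
          using c by (simp add: s_def)
      qed
      ultimately show ?thesis
        using least[of s] by simp
    qed
    then have "r = 0"
      using \<open>p dvd r\<close> r_less gauss_norm_le_of_dvd[of p r] by linarith
    then have "p = p div c * c"
      by (simp add: r_def)
    then have "is_unit (p div c) \<or> is_unit c"
      using assms irreducibleD by blast
    then show False
    proof
      assume "is_unit (p div c)"
      then have "p dvd c"
        using \<open>p = p div c * c\<close> by (metis dvd_refl mult_unit_dvd_iff')
      then show False
        using c by blast
    next
      assume "is_unit c"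
      then have "p dvd b"
        using c by (simp add: dvd_mult_unit_iff')
      then show False
        using not_dvd by blast
    qed
  qed
qed

section \<open>Primes avoiding a given element\<close>

text \<open>
  Among the numbers \<open>1 + k * \<alpha>\<close>, the factor \<open>k = 3\<close> guarantees absolute value at least
  \<open>3 * \<bar>\<alpha>\<bar> - 1 \<ge> 2\<close>, which rules out zero and the units.
\<close>

lemma coprime_set_contains_prime:
  assumes "\<alpha> \<noteq> 0"
  shows "\<exists>p \<in> coprime_set \<alpha>. prime_elem p"
proof -
  define \<beta> where "\<beta> = 1 + 3 * \<alpha>"
  define z where "z = complex_of_gauss \<alpha>"
  have "gauss_norm \<alpha> \<ge> 1"
    using assms gauss_norm_eq_0_iff[of \<alpha>] by linarith
  then have "1 \<le> (cmod z)\<^sup>2"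
    unfolding z_def real_gauss_norm[symmetric] by simp
  then have "1 \<le> cmod z"
    using power2_le_imp_le[of 1 "cmod z"] by simp
  moreover have "complex_of_gauss 3 = 3"
  proof -
    have "complex_of_gauss (1 + 1 + 1) = 1 + 1 + 1"
      by (simp only: plus_gauss_int.rep_eq one_gauss_int.rep_eq)
    then show ?thesis
      by simp
  qed
  then have "complex_of_gauss \<beta> = 3 * z + 1"
    by (simp add: \<beta>_def z_def plus_gauss_int.rep_eq times_gauss_int.rep_eq one_gauss_int.rep_eq)
  moreover have "cmod (3 * z) - cmod 1 \<le> cmod (3 * z + 1)"
    by (rule norm_diff_ineq)
  ultimately have "2 \<le> cmod (complex_of_gauss \<beta>)"
    by (simp add: norm_mult)
  then have "2\<^sup>2 \<le> real (gauss_norm \<beta>)"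
    unfolding real_gauss_norm by (intro power_mono) auto
  then have "\<beta> \<noteq> 0" "\<not> is_unit \<beta>"
    using gauss_norm_eq_0_iff[of \<beta>] is_unit_gauss_iff[of \<beta>] by auto
  then obtain p where p: "irreducible p" "p dvd \<beta>"
    by (rule irreducible_divisor_exists)
  have "coprime \<alpha> p"
  proof (rule coprimeI)
    fix c
    assume "c dvd \<alpha>" "c dvd p"
    then have "c dvd \<beta> - 3 * \<alpha>"
      using p by (intro dvd_diff dvd_mult) (auto intro: dvd_trans)
    then show "is_unit c"
      by (simp add: \<beta>_def)
  qed
  moreover have "p \<noteq> 0"
    using p by (auto simp: irreducible_def)
  ultimately show ?thesis
    using p irreducible_imp_prime_elem_gauss by (auto simp: coprime_set_def)
qed

section \<open>Density in the coprimality topology\<close>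

text \<open>
  The sets \<open>\<sigma>\<^bsub>\<alpha>\<^esub>\<close> form a \<open>\<pi>\<close>-base. Asking only that some \<open>\<sigma>\<^bsub>\<alpha>\<^esub>\<close> lie in the open set, and not
  that it contain a prescribed point, is enough for density, and makes the case of intersections
  depend only on the trivial direction of multiplicativity of coprimality.
\<close>

lemma nonempty_openin_contains_coprime_set:
  assumes "openin coprimality_topology U" "U \<noteq> {}"
  shows "\<exists>\<alpha>. \<alpha> \<noteq> 0 \<and> coprime_set \<alpha> \<subseteq> U"
proof -
  have "generate_topology_on (coprime_set ` (UNIV - {0})) U"
    using assms by (simp add: coprimality_topology_def openin_topology_generated_by_iff)
  then show ?thesis
    using \<open>U \<noteq> {}\<close>
  proof (induction rule: generate_topology_on.induct)
    case Empty
    then show ?case by simp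
  next
    case (Int U V)
    then obtain \<alpha> \<beta> where "\<alpha> \<noteq> 0" "coprime_set \<alpha> \<subseteq> U" "\<beta> \<noteq> 0" "coprime_set \<beta> \<subseteq> V"
      by auto
    moreover have "coprime_set (\<alpha> * \<beta>) \<subseteq> coprime_set \<alpha> \<inter> coprime_set \<beta>"
      unfolding coprime_set_def coprime_def by (blast intro: dvd_mult dvd_mult2)
    moreover have "\<alpha> * \<beta> \<noteq> 0"
      using \<open>\<alpha> \<noteq> 0\<close> \<open>\<beta> \<noteq> 0\<close> by simp
    ultimately show ?case
      by blast
  next
    case (UN K)
    then show ?case by blast
  next
    case (Basis U)
    then show ?case by auto
  qed
qed

theorem theorem5p1:
  "coprimality_topology closure_of {p. prime_elem p} = UNIV - {0} \<and>
   (\<forall>\<alpha>. \<alpha> \<noteq> 0 \<longrightarrow> (\<exists>p \<in> coprime_set \<alpha>. prime_elem p))"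
proof
  show "\<forall>\<alpha>. \<alpha> \<noteq> 0 \<longrightarrow> (\<exists>p \<in> coprime_set \<alpha>. prime_elem p)"
    using coprime_set_contains_prime by blast
  have "\<exists>p. prime_elem p \<and> p \<in> U" if "openin coprimality_topology U" "z \<in> U" for U z
    using nonempty_openin_contains_coprime_set[of U] coprime_set_contains_prime that by blast
  then show "coprimality_topology closure_of {p. prime_elem p} = UNIV - {0}"
    by (auto simp: closure_of_def topspace_coprimality_topology)
qed

end
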